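(* Let $L\in\mathbb{N}$ and $\Omega=\{1,\dots,L\}$. Let $F,\tilde F\in\mathbb{R}^{L\times L}$ be stochastic matrices, let $S\in\mathbb{R}^{L\times L}$ be substochastic and irreducible, and assume that $F\ge S$ and $\tilde F\ge S$ entrywise. Then for every $m\in\Omega$, $$\left|\log \pi_m(\tilde F)-\log\pi_m(F)\right|\le \sum_{\substack{i,j\in\Omega\\ i\ne j}}\left|\log\left(\tilde F_{ij}-S_{ij}+\mathbf{Q}_{ij}(S)\right)-\log\left(F_{ij}-S_{ij}+\mathbf{Q}_{ij}(S)\right)\right|.$$
   Context: A matrix is stochastic if its entries are nonnegative and every row sums to $1$; it is substochastic if its entries are nonnegative and every row sums to at most $1$ (stochastic $S$ is allowed). Inequalities between matrices are entrywise. For an irreducible stochastic matrix $G\in\mathbb{R}^{L\times L}$, $\pi(G)\in\mathbb{R}^L$ denotes its invariant distribution, i.e. the unique vector with $\pi(G)^{\mathrm t}G=\pi(G)^{\mathrm t}$ and $\sum_i\pi_i(G)=1$; all its entries are positive. (Since $S$ is irreducible and $F,\tilde F\ge S$, the matrices $F,\tilde F$ are irreducible.) Definition of $\mathbf{Q}_{ij}(S)$: let $X^\omega$ be the discrete time Markov chain on $\Omega\cup\{\omega\}$, with $\omega\notin\Omega$ an additional absorbing state, whose transition matrix $S^\omega$ is given by $S^\omega_{kl}=S_{kl}$ for $k,l\in\Omega$, $S^\omega_{k\omega}=1-\sum_{l\in\Omega}S_{kl}$ for $k\in\Omega$, $S^\omega_{\omega k}=0$ for $k\in\Omega$, and $S^\omega_{\omega\omega}=1$.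 For a state $k$, let $\tau_k=\min\{s>0: X^\omega_s=k\}$ (with $\min\emptyset=\infty$). For $i,j\in\Omega$ with $i\neq j$, $$\mathbf{Q}_{ij}(S):=\mathbf{P}\left[\tau_j<\min\{\tau_i,\tau_\omega\}\,\middle|\,X^\omega_0=i\right].$$ *)

theory Defs
  imports "HOL-Probability.Probability"
begin

definition substochastic :: "real ^ 'n ^ 'n::finite \<Rightarrow> bool" where
  "substochastic A \<longleftrightarrow> (\<forall>i j. 0 \<le> A $ i $ j) \<and> (\<forall>i. (\<Sum>j\<in>UNIV. A $ i $ j) \<le> 1)"

definition stochastic :: "real ^ 'n ^ 'n::finite \<Rightarrow> bool" where
  "stochastic A \<longleftrightarrow> (\<forall>i j. 0 \<le> A $ i $ j) \<and> (\<forall>i. (\<Sum>j\<in>UNIV. A $ i $ j) = 1)"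

text \<open>
  Irreducibility means strong connectedness of the directed graph of nonzero entries.  The
  reflexive closure only matters for \<open>1 \<times> 1\<close> matrices, which are all irreducible here.
\<close>
definition irreducible_mat :: "real ^ 'n ^ 'n::finite \<Rightarrow> bool" where
  "irreducible_mat A \<longleftrightarrow> (\<forall>i j. (i, j) \<in> {(k, l). A $ k $ l \<noteq> 0}\<^sup>*)"

text \<open>Meaningful only where such a vector exists uniquely, as for irreducible stochastic \<open>G\<close>.\<close>
definition invariant_distribution :: "real ^ 'n ^ 'n::finite \<Rightarrow> real ^ 'n" where
  "invariant_distribution G = (THE p. p v* G = p \<and> (\<Sum>i\<in>UNIV. p $ i) = 1)"

text \<open>
  The law on path space of the Markov chain with transition matrix \<open>P\<close> started at \<open>x\<close>, obtained
  from the Ionescu-Tulcea theorem: time \<open>0\<close> is distributed as the point mass at \<open>x\<close>, and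
  conditionally on a past ending in \<open>k\<close> the next state is distributed as row \<open>k\<close> of \<open>P\<close>.
\<close>
definition chain_kernel ::
    "real ^ 'a ^ 'a::finite \<Rightarrow> 'a \<Rightarrow> nat \<Rightarrow> (nat \<Rightarrow> 'a) \<Rightarrow> 'a measure" where
  "chain_kernel P x n X =
    (case n of 0 \<Rightarrow> return (count_space UNIV) x
     | Suc m \<Rightarrow> point_measure UNIV (\<lambda>l. ennreal (P $ X m $ l)))"

definition markov_chain :: "real ^ 'a ^ 'a::finite \<Rightarrow> 'a \<Rightarrow> (nat \<Rightarrow> 'a) measure" where
  "markov_chain P x =
    projective_family.lim UNIV (Ionescu_Tulcea.CI (chain_kernel P x) (\<lambda>_. count_space UNIV))
      (\<lambda>_. count_space UNIV)"

lemma Ionescu_Tulcea_chain_kernel: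
  assumes "stochastic P"
  shows "Ionescu_Tulcea (chain_kernel P x) (\<lambda>_. count_space UNIV)"
proof -
  have row: "prob_space (point_measure UNIV (\<lambda>l. ennreal (P $ k $ l)))" for k
    using assms
    by (intro prob_spaceI)
      (auto simp: emeasure_point_measure_finite space_point_measure stochastic_def sum_ennreal)
  have sub: "(\<lambda>k. point_measure UNIV (\<lambda>l. ennreal (P $ k $ l)))
      \<in> count_space UNIV \<rightarrow>\<^sub>M subprob_algebra (count_space UNIV)"
    by (auto simp: space_subprob_algebra sets_point_measure
      intro!: prob_space_imp_subprob_space row)
  show ?thesis
    unfolding Ionescu_Tulcea_def
  proof (intro conjI allI impI)
    fix n
    show "chain_kernel P x n \<in> Pi\<^sub>M {0..<n} (\<lambda>_. count_space UNIV)
        \<rightarrow>\<^sub>M subprob_algebra (count_space UNIV)"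
    proof (cases n)
      case 0
      then show ?thesis
        by (auto simp: chain_kernel_def[abs_def] space_subprob_algebra
          intro!: measurable_const prob_space_imp_subprob_space prob_space_return)
    next
      case (Suc m)
      have "(\<lambda>X. X m) \<in> Pi\<^sub>M {0..<n} (\<lambda>_. count_space UNIV) \<rightarrow>\<^sub>M count_space UNIV"
        using Suc by (intro measurable_component_singleton) auto
      from measurable_compose[OF this sub] show ?thesis
        using Suc by (simp add: chain_kernel_def[abs_def])
    qed
  next
    fix n and X :: "nat \<Rightarrow> 'a"
    show "prob_space (chain_kernel P x n X)"
      by (cases n) (auto simp: chain_kernel_def row intro!: prob_space_return)
  qed
qed

lemma sets_markov_chain:
  assumes "stochastic P"
  shows "sets (markov_chain P x) = sets (Pi\<^sub>M UNIV (\<lambda>_. count_space UNIV))"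
proof -
  interpret Ionescu_Tulcea "chain_kernel P x" "\<lambda>_. count_space UNIV"
    by (rule Ionescu_Tulcea_chain_kernel) fact
  show ?thesis by (simp add: markov_chain_def)
qed

lemma prob_space_markov_chain:
  assumes "stochastic P"
  shows "prob_space (markov_chain P x)"
proof -
  interpret Ionescu_Tulcea "chain_kernel P x" "\<lambda>_. count_space UNIV"
    by (rule Ionescu_Tulcea_chain_kernel) fact
  have emb: "prod_emb UNIV (\<lambda>_::nat. count_space (UNIV :: 'a set)) {} {\<lambda>_. undefined} = UNIV"
    by (auto simp: prod_emb_def)
  interpret E: prob_space "CI {}" by (rule PF.prob_space_P) auto
  have "space (CI {}) = {\<lambda>_. undefined}"
    by (subst PF.space_P) (auto simp: space_PiM)
  then have "emeasure PF.lim UNIV = 1"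
    using lim[of "{}" "{\<lambda>_. undefined}"] E.emeasure_space_1
    by (simp add: emb sets_PiM_empty)
  then show ?thesis
    unfolding markov_chain_def by (intro prob_spaceI) (simp add: space_PiM)
qed

lemma measure_markov_chain_cylinder:
  assumes stoch: "stochastic P"
  shows "measure (markov_chain P x) {X \<in> space (markov_chain P x). \<forall>t\<le>n. X t = y t} =
    (if y 0 = x then \<Prod>t<n. P $ y t $ y (Suc t) else 0)"
proof -
  let ?M = "\<lambda>_::nat. count_space (UNIV :: 'a set)"
  interpret Ionescu_Tulcea "chain_kernel P x" ?M
    by (rule Ionescu_Tulcea_chain_kernel) fact
  let ?u = "\<lambda>_::nat. undefined :: 'a"
  define A where "A n = {X \<in> space (Pi\<^sub>M {0..<n} ?M). \<forall>t<n. X t = y t}" for n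
  define p where "p n = (case n of 0 \<Rightarrow> (if y 0 = x then 1 else 0) | Suc m \<Rightarrow> P $ y m $ y n)" for n
  have nonneg: "0 \<le> P $ k $ l" for k l
    using stoch by (simp add: stochastic_def)
  have p_nonneg: "0 \<le> p n" for n
    by (cases n) (auto simp: p_def nonneg)
  have u[simp]: "?u \<in> space (Pi\<^sub>M {0..<0} ?M)"
    by (simp add: space_PiM)
  have A_sets[measurable]: "A n \<in> sets (Pi\<^sub>M {0..<n} ?M)" for n
  proof -
    have "A n = (\<Pi>\<^sub>E t\<in>{0..<n}. {y t})"
      by (auto simp: A_def space_PiM PiE_iff extensional_def)
    then show ?thesis by (simp add: sets_PiM_I_finite)
  qed
  have step: "emeasure (eP n X) (A (Suc n)) = ennreal (p n) * indicator (A n) X"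
    if X: "X \<in> space (Pi\<^sub>M {0..<n} ?M)" for n X
  proof -
    have "(\<lambda>l. X(n := l)) -` A (Suc n) \<inter> space (?M n) = (if X \<in> A n then {y n} else {})"
      using X by (auto simp: A_def space_PiM PiE_iff extensional_def less_Suc_eq)
    moreover have "emeasure (chain_kernel P x n X) {y n} = ennreal (p n)" if "X \<in> A n"
    proof (cases n)
      case 0
      then show ?thesis by (auto simp: chain_kernel_def p_def)
    next
      case (Suc m)
      then have "X m = y m" using \<open>X \<in> A n\<close> by (simp add: A_def)
      then show ?thesis using Suc
        by (simp add: chain_kernel_def p_def emeasure_point_measure_finite)
    qed
    ultimately show ?thesis
      using emeasure_eP[OF X A_sets] by simp
  qed
  have C: "emeasure (C 0 n ?u) (A n) = ennreal (\<Prod>t<n. p t)" for n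
  proof (induction n)
    case 0
    have "A 0 = {?u}" by (auto simp: A_def space_PiM)
    then show ?case by (simp add: space_PiM sets_PiM_empty)
  next
    case (Suc n)
    have sets: "sets (C 0 n ?u) = sets (Pi\<^sub>M {0..<n} ?M)"
      using sets_C[OF u, of n] by simp
    note space = sets_eq_imp_space_eq[OF sets]
    have "emeasure (C 0 (Suc n) ?u) (A (Suc n)) = (\<integral>\<^sup>+X. emeasure (eP n X) (A (Suc n)) \<partial>C 0 n ?u)"
      using measurable_eP[of n] prob_space.not_empty[OF prob_space_C[OF u, of n]]
      by (simp add: emeasure_bind[where N = "Pi\<^sub>M {0..<Suc n} ?M"]
        measurable_cong_sets[OF sets refl] del: space_PiM_empty_iff)
    also have "\<dots> = (\<integral>\<^sup>+X. ennreal (p n) * indicator (A n) X \<partial>C 0 n ?u)"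
      by (intro nn_integral_cong step) (simp add: space)
    also have "\<dots> = ennreal (p n) * emeasure (C 0 n ?u) (A n)"
      by (simp add: nn_integral_cmult_indicator sets)
    also have "\<dots> = ennreal (\<Prod>t<Suc n. p t)"
      by (simp add: Suc.IH ennreal_mult p_nonneg prod_nonneg mult.commute)
    finally show ?case .
  qed
  have "{X \<in> space (markov_chain P x). \<forall>t\<le>n. X t = y t} = PF.emb UNIV {0..<Suc n} (A (Suc n))"
    by (auto simp: markov_chain_def A_def prod_emb_def space_PiM less_Suc_eq_le)
  then have "emeasure (markov_chain P x) {X \<in> space (markov_chain P x). \<forall>t\<le>n. X t = y t}
      = emeasure (CI {0..<Suc n}) (A (Suc n))"
    unfolding markov_chain_def by (simp only: lim[OF finite_atLeastLessThan A_sets])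
  also have "\<dots> = ennreal (\<Prod>t<Suc n. p t)"
  proof -
    have "PF.emb {0..<Suc n} {0..<Suc n} (A (Suc n)) = A (Suc n)"
      by (rule prod_emb_id) (auto simp: A_def space_PiM)
    then show ?thesis
      using emeasure_CI[OF subset_refl A_sets[of "Suc n"]] C[of "Suc n"] by simp
  qed
  finally have "measure (markov_chain P x) {X \<in> space (markov_chain P x). \<forall>t\<le>n. X t = y t}
      = (\<Prod>t<Suc n. p t)"
    by (simp add: measure_def prod_nonneg p_nonneg del: prod.lessThan_Suc)
  also have "\<dots> = (if y 0 = x then \<Prod>t<n. P $ y t $ y (Suc t) else 0)"
    by (subst prod.lessThan_Suc_shift) (simp add: p_def)
  finally show ?thesis .
qed

text \<open>As \<open>Inf {} = \<infinity>\<close> on \<^typ>\<open>enat\<close>, the value is \<open>\<infinity>\<close> if \<open>k\<close> is never hit at a positive time.\<close>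
definition hitting_time :: "'a \<Rightarrow> (nat \<Rightarrow> 'a) \<Rightarrow> enat" where
  "hitting_time k X = Inf {enat s | s. 0 < s \<and> X s = k}"

text \<open>The absorbing state \<open>\<omega>\<close> is \<^term>\<open>None\<close>.\<close>
definition absorbing_extension :: "real ^ 'n ^ 'n::finite \<Rightarrow> real ^ 'n option ^ 'n option" where
  "absorbing_extension S = (\<chi> k l.
    case k of
      None \<Rightarrow> (case l of None \<Rightarrow> 1 | Some _ \<Rightarrow> 0)
    | Some k' \<Rightarrow> (case l of None \<Rightarrow> 1 - (\<Sum>l'\<in>UNIV. S $ k' $ l') | Some l' \<Rightarrow> S $ k' $ l'))"

definition Q_passage :: "real ^ 'n ^ 'n::finite \<Rightarrow> 'n \<Rightarrow> 'n \<Rightarrow> real" where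
  "Q_passage S i j =
    \<P>(X in markov_chain (absorbing_extension S) (Some i).
      hitting_time (Some j) X < min (hitting_time (Some i) X) (hitting_time None X))"

lemma stochastic_absorbing_extension:
  assumes "substochastic S"
  shows "stochastic (absorbing_extension S)"
proof -
  have "(\<Sum>l\<in>UNIV. absorbing_extension S $ k $ l) = 1" for k
    by (cases k) (simp_all add: absorbing_extension_def UNIV_option_conv sum.reindex)
  then show ?thesis
    using assms
    by (auto simp: stochastic_def substochastic_def absorbing_extension_def split: option.splits)
qed

end

theory Submission
  imports Defs
begin

text \<open>
  The matrices \<open>G(s) = F + s (F' - F)\<close> on the segment from \<open>F\<close> to \<open>F'\<close> are stochastic and
  dominate \<open>S\<close>, so it suffices to bound the speed of \<open>ln \<pi>\<^sub>m(G(s))\<close> by the sum of the speeds of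
  \<open>ln (G\<^sub>i\<^sub>j(s) - S\<^sub>i\<^sub>j + Q\<^sub>i\<^sub>j(S))\<close>.  Each of these logarithms is monotone along the segment, because
  its argument is affine in \<open>s\<close>; hence integrating the speed gives exactly the absolute difference
  of the end values.

  The speed of \<open>ln \<pi>\<^sub>m\<close> is found with the mean hitting times \<open>h\<close> of \<open>m\<close> under \<open>G\<close>, which solve the Poisson
  equation \<open>h - G h = 1 - e\<^sub>m / \<pi>\<^sub>m\<close>.  Pairing it with the invariant distribution of another chain
  gives an exact formula for the relative change of \<open>\<pi>\<^sub>m\<close>
  (\<open>invariant_distribution_perturbation\<close>), and in the limit
  \<open>(ln \<pi>\<^sub>m)' = (\<Sum>i\<noteq>j. \<pi>\<^sub>i (F'\<^sub>i\<^sub>j - F\<^sub>i\<^sub>j) (h\<^sub>i - h\<^sub>j))\<close>.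

  It remains to see that \<open>\<pi>\<^sub>i \<bar>h\<^sub>i - h\<^sub>j\<bar> (G\<^sub>i\<^sub>j - S\<^sub>i\<^sub>j + Q\<^sub>i\<^sub>j(S)) \<le> 1\<close>.  By the triangle inequality for
  hitting times, \<open>\<bar>h\<^sub>i - h\<^sub>j\<bar>\<close> is at most the mean commute time \<open>c\<close> between \<open>i\<close> and \<open>j\<close>.  The number
  \<open>1 / (\<pi>\<^sub>i c)\<close> is the probability that the chain \<open>G\<close> started at \<open>i\<close> visits \<open>j\<close> before it returns to
  \<open>i\<close>.  This passage can be made by a first step straight to \<open>j\<close>, or by a longer path, whose weight
  under \<open>G\<close> is at least its weight under \<open>S\<close>; so the probability is at least
  \<open>G\<^sub>i\<^sub>j + (Q\<^sub>i\<^sub>j(S) - S\<^sub>i\<^sub>j)\<close> (\<open>commute_time_Q_passage_bound\<close>).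

  Everything about hitting times comes from the maximum principle for irreducible chains; paths of
  the chain enter only where \<open>Q\<^sub>i\<^sub>j(S)\<close> is expanded as a series over the length of the passage
  (\<open>Q_passage_sums\<close>).
\<close>

section \<open>The maximum principle\<close>

lemma irreducible_mat_mono:
  assumes "irreducible_mat S" and "substochastic S" and "\<And>i j. S $ i $ j \<le> F $ i $ j"
  shows "irreducible_mat F"
proof -
  have "{(k, l). S $ k $ l \<noteq> 0} \<subseteq> {(k, l). F $ k $ l \<noteq> 0}"
  proof clarify
    fix k l assume "S $ k $ l \<noteq> 0" "F $ k $ l = 0"
    moreover have "0 \<le> S $ k $ l" using assms(2) by (simp add: substochastic_def)
    ultimately show False using assms(3)[of k l] by simp
  qed
  from rtrancl_mono[OF this] show ?thesis
    using assms(1) unfolding irreducible_mat_def by blast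
qed

text \<open>
  Wherever the maximum is attained, other than at \<open>j\<close>, averaging forces it to be attained at all
  successors as well; following a path of nonzero entries it reaches \<open>j\<close>.
\<close>
lemma maximum_principle:
  fixes f :: "real ^ 'n::finite"
  assumes F: "stochastic F" "irreducible_mat F"
    and sub: "\<And>k. k \<noteq> j \<Longrightarrow> f $ k \<le> (F *v f) $ k"
  shows "f $ k \<le> f $ j"
proof -
  define M where "M = Max (range (($) f))"
  have le: "f $ l \<le> M" for l by (simp add: M_def)
  have "M \<in> range (($) f)" unfolding M_def by (rule Max_in) auto
  then obtain k0 where k0: "f $ k0 = M" by auto
  have nonneg: "0 \<le> F $ k $ l" for k l using F(1) by (simp add: stochastic_def)
  have step: "f $ l = M" if "f $ k = M" "k \<noteq> j" "F $ k $ l \<noteq> 0" for k l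
  proof -
    have "(\<Sum>l\<in>UNIV. F $ k $ l * (M - f $ l)) = M - (F *v f) $ k"
      using F(1) by (simp add: right_diff_distrib sum_subtractf matrix_vector_mult_def
        stochastic_def flip: sum_distrib_right)
    also have "\<dots> \<le> 0" using sub[OF that(2)] that(1) by simp
    finally have "(\<Sum>l\<in>UNIV. F $ k $ l * (M - f $ l)) = 0"
      using sum_nonneg[of UNIV "\<lambda>l. F $ k $ l * (M - f $ l)"] by (simp add: nonneg le)
    then have "F $ k $ l * (M - f $ l) = 0"
      by (subst (asm) sum_nonneg_eq_0_iff) (auto simp: nonneg le)
    then show ?thesis using that(3) by simp
  qed
  have "(k0, j) \<in> {(k, l). F $ k $ l \<noteq> 0}\<^sup>*"
    using F(2) by (simp add: irreducible_mat_def)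
  \<comment> \<open>The second disjunct lets the induction stop as soon as the path meets \<open>j\<close>, where the value
    need not propagate further.\<close>
  then have "f $ j = M \<or> f $ j = M"
    by (induction rule: rtrancl_induct[where P = "\<lambda>l. f $ l = M \<or> f $ j = M"])
      (use k0 step in auto)
  then show ?thesis using le by simp
qed

section \<open>Mean hitting times and the invariant distribution\<close>

text \<open>
  The mean time to reach \<open>j\<close>, as a function of the starting state, is specified by first-step
  analysis, since only this linear system is ever used.  It vanishes at \<open>j\<close> itself, in contrast to
  the mean return time below.
\<close>
definition mean_hitting_time :: "real ^ 'n ^ 'n::finite \<Rightarrow> 'n \<Rightarrow> real ^ 'n" where
  "mean_hitting_time F j = (SOME h. h $ j = 0 \<and> (\<forall>k. k \<noteq> j \<longrightarrow> h $ k = 1 + (F *v h) $ k))"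

definition mean_return_time :: "real ^ 'n ^ 'n::finite \<Rightarrow> 'n \<Rightarrow> real" where
  "mean_return_time F j = 1 + (F *v mean_hitting_time F j) $ j"

text \<open>
  The linear system is square, so it is solvable if its homogeneous version has only the zero
  solution; by the maximum principle for \<open>f\<close> and \<open>- f\<close>, a function that is harmonic away from \<open>j\<close>
  and zero at \<open>j\<close> vanishes.
\<close>
lemma mean_hitting_time:
  fixes F :: "real ^ 'n ^ 'n::finite"
  assumes F: "stochastic F" "irreducible_mat F"
  shows "mean_hitting_time F j $ j = 0"
    and "k \<noteq> j \<Longrightarrow> mean_hitting_time F j $ k = 1 + (F *v mean_hitting_time F j) $ k"
proof -
  define T where "T f = (\<chi> k. if k = j then f $ j else f $ k - (F *v f) $ k)" for f :: "real ^ 'n"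
  have lin: "linear T"
    by (rule linearI)
      (auto simp: T_def vec_eq_iff matrix_vector_right_distrib matrix_vector_mult_scaleR algebra_simps)
  have "f = 0" if "T f = 0" for f
  proof -
    have T0: "T f $ k = 0" for k using that by simp
    have fj: "f $ j = 0" using T0[of j] by (simp add: T_def)
    have eq: "f $ k = (F *v f) $ k" if "k \<noteq> j" for k
      using T0[of k] that by (simp add: T_def)
    have "f $ k \<le> 0" for k
      using maximum_principle[OF F, of j f k] eq fj by simp
    moreover have "(- f) $ k \<le> (- f) $ j" for k
      by (rule maximum_principle[OF F])
        (use eq in \<open>simp add: matrix_vector_mult_def sum_negf\<close>)
    ultimately show ?thesis using fj by (simp add: vec_eq_iff antisym)
  qed
  then have "inj T" using lin by (simp add: linear_injective_0)
  then have "surj T" using lin linear_injective_imp_surjective by blast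
  then obtain h where h: "T h = (\<chi> k. if k = j then 0 else 1)" by (metis surjD)
  have "h $ j = 0 \<and> (\<forall>k. k \<noteq> j \<longrightarrow> h $ k = 1 + (F *v h) $ k)"
    using h by (auto simp: T_def vec_eq_iff split: if_splits)
  from someI[of "\<lambda>h. h $ j = 0 \<and> (\<forall>k. k \<noteq> j \<longrightarrow> h $ k = 1 + (F *v h) $ k)", OF this]
  show "mean_hitting_time F j $ j = 0"
    and "k \<noteq> j \<Longrightarrow> mean_hitting_time F j $ k = 1 + (F *v mean_hitting_time F j) $ k"
    unfolding mean_hitting_time_def by auto
qed

lemma mean_hitting_time_Poisson:
  assumes F: "stochastic F" "irreducible_mat F"
  shows "mean_hitting_time F j $ k - (F *v mean_hitting_time F j) $ k
    = 1 - (if k = j then mean_return_time F j else 0)"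
  using mean_hitting_time[OF F, where j = j] by (auto simp: mean_return_time_def)

lemma mean_hitting_time_nonneg:
  assumes F: "stochastic F" "irreducible_mat F"
  shows "0 \<le> mean_hitting_time F j $ k"
proof -
  have "(- mean_hitting_time F j) $ k \<le> (- mean_hitting_time F j) $ j"
    by (rule maximum_principle[OF F])
      (simp add: matrix_vector_mult_def sum_negf mean_hitting_time(2)[OF F])
  then show ?thesis using mean_hitting_time(1)[OF F] by simp
qed

lemma mean_return_time_ge_1:
  assumes F: "stochastic F" "irreducible_mat F"
  shows "1 \<le> mean_return_time F j"
  using F(1) mean_hitting_time_nonneg[OF F]
  by (auto simp: mean_return_time_def matrix_vector_mult_def stochastic_def intro!: sum_nonneg)

text \<open>
  This is Kac's formula: pair the Poisson equation with an invariant row vector, which annihilates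
  its left-hand side.  The vector is arbitrary, so that the formula yields uniqueness and the value
  of the invariant distribution alike.
\<close>
lemma sum_invariant_vector:
  assumes F: "stochastic F" "irreducible_mat F" and p: "p v* F = p"
  shows "(\<Sum>k\<in>UNIV. p $ k) = p $ j * mean_return_time F j"
proof -
  let ?h = "mean_hitting_time F j"
  have "0 = p \<bullet> (?h - F *v ?h)"
    using dot_lmul_matrix[of p F ?h] p by (simp add: inner_diff_right)
  also have "\<dots> = (\<Sum>k\<in>UNIV. p $ k * (1 - (if k = j then mean_return_time F j else 0)))"
    by (simp add: inner_vec_def mean_hitting_time_Poisson[OF F])
  also have "\<dots> = (\<Sum>k\<in>UNIV. p $ k) - p $ j * mean_return_time F j"
    by (simp add: right_diff_distrib sum_subtractf if_distrib[of "(*) _"] cong: if_cong)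
  finally show ?thesis by simp
qed

text \<open>
  The matrix \<open>1 - F\<close> kills the constant vector, hence so does its transpose some nonzero \<open>p\<close>.  Kac's
  formula shows that \<open>p\<close> has nonzero sum and that its normalisation is determined by the mean
  return times.
\<close>
lemma invariant_distribution:
  fixes F :: "real ^ 'n ^ 'n::finite"
  assumes F: "stochastic F" "irreducible_mat F"
  shows "invariant_distribution F v* F = invariant_distribution F"
    and "(\<Sum>k\<in>UNIV. invariant_distribution F $ k) = 1"
    and "invariant_distribution F $ j = 1 / mean_return_time F j"
proof -
  have r: "mean_return_time F j \<noteq> 0" for j
    using mean_return_time_ge_1[OF F, of j] by simp
  have "(mat 1 - F) *v 1 = 0"
    using F(1) by (simp add: vec_eq_iff matrix_vector_mult_def stochastic_def sum_subtractf mat_def)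
  then have "\<exists>p. p \<noteq> 0 \<and> transpose (mat 1 - F) *v p = 0"
    unfolding matrix_nonfull_linear_equations_eq rank_transpose
    by (metis (mono_tags) matrix_nonfull_linear_equations_eq zero_neq_one)
  then obtain p where p0: "p \<noteq> 0" and "transpose (mat 1 - F) *v p = 0" by blast
  moreover have "transpose (mat 1 - F) = mat 1 - transpose F"
    by (auto simp: vec_eq_iff transpose_def mat_def)
  ultimately have p: "p v* F = p"
    by (simp add: matrix_vector_mult_diff_rdistrib)
  define s where "s = (\<Sum>k\<in>UNIV. p $ k)"
  have ps: "s = p $ j * mean_return_time F j" for j
    unfolding s_def by (rule sum_invariant_vector[OF F p])
  have "s \<noteq> 0"
  proof
    assume "s = 0"
    then have "p $ j = 0" for j using ps[of j] r[of j] by simp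
    with p0 show False by (simp add: vec_eq_iff)
  qed
  define q where "q = (1 / s) *\<^sub>R p"
  have q: "q v* F = q \<and> (\<Sum>k\<in>UNIV. q $ k) = 1"
    using \<open>s \<noteq> 0\<close> p
    by (simp add: q_def scaleR_vector_matrix_assoc s_def flip: sum_divide_distrib)
  have val: "q' $ j = 1 / mean_return_time F j"
    if "q' v* F = q' \<and> (\<Sum>k\<in>UNIV. q' $ k) = 1" for q' j
  proof -
    have "q' $ j * mean_return_time F j = 1"
      using sum_invariant_vector[OF F conjunct1[OF that], of j] conjunct2[OF that] by linarith
    then show ?thesis using r[of j] by (simp add: nonzero_eq_divide_eq)
  qed
  have eq: "invariant_distribution F = q"
    unfolding invariant_distribution_def
  proof (rule the_equality)
    show "q' = q" if "q' v* F = q' \<and> (\<Sum>k\<in>UNIV. q' $ k) = 1" for q'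
      unfolding vec_eq_iff using val[OF that] val[OF q] by metis
  qed (rule q)
  show "invariant_distribution F v* F = invariant_distribution F"
    and "(\<Sum>k\<in>UNIV. invariant_distribution F $ k) = 1"
    unfolding eq using q by blast+
  show "invariant_distribution F $ j = 1 / mean_return_time F j"
    unfolding eq by (rule val[OF q])
qed

lemma invariant_distribution_pos:
  assumes F: "stochastic F" "irreducible_mat F"
  shows "0 < invariant_distribution F $ j"
  using mean_return_time_ge_1[OF F, of j] by (simp add: invariant_distribution(3)[OF F])

text \<open>
  Away from \<open>j\<close> the difference of the two hitting times of \<open>m\<close> and \<open>j\<close> is subharmonic: the constant
  source terms cancel and only the nonpositive point source at \<open>m\<close> is left.
\<close>
lemma mean_hitting_time_triangle:
  assumes F: "stochastic F" "irreducible_mat F"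
  shows "mean_hitting_time F m $ i \<le> mean_hitting_time F j $ i + mean_hitting_time F m $ j"
proof -
  let ?f = "mean_hitting_time F m - mean_hitting_time F j"
  have "?f $ i \<le> ?f $ j"
  proof (rule maximum_principle[OF F])
    fix k assume "k \<noteq> j"
    then have "?f $ k - (F *v ?f) $ k = - (if k = m then mean_return_time F m else 0)"
      using mean_hitting_time_Poisson[OF F, of m k] mean_hitting_time_Poisson[OF F, of j k]
      by (simp add: matrix_vector_mult_diff_distrib)
    also have "\<dots> \<le> 0" using mean_return_time_ge_1[OF F, of m] by simp
    finally show "?f $ k \<le> (F *v ?f) $ k" by simp
  qed
  then show ?thesis using mean_hitting_time(1)[OF F, of j] by simp
qed

definition mean_commute_time :: "real ^ 'n ^ 'n::finite \<Rightarrow> 'n \<Rightarrow> 'n \<Rightarrow> real" where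
  "mean_commute_time F i j = mean_hitting_time F j $ i + mean_hitting_time F i $ j"

lemma mean_hitting_time_diff_le_commute:
  assumes F: "stochastic F" "irreducible_mat F"
  shows "\<bar>mean_hitting_time F m $ i - mean_hitting_time F m $ j\<bar> \<le> mean_commute_time F i j"
  using mean_hitting_time_triangle[OF F, of m i j] mean_hitting_time_triangle[OF F, of m j i]
    mean_hitting_time_nonneg[OF F, of j i] mean_hitting_time_nonneg[OF F, of i j]
  by (simp add: mean_commute_time_def)

section \<open>Passages between two states\<close>

text \<open>
  The total weight of the paths from \<open>k\<close> to \<open>j\<close> that make \<open>n + 1\<close> steps and avoid \<open>i\<close> and \<open>j\<close> in
  between; \<open>k\<close> itself may be one of these two states.
\<close>
primrec passage_weight :: "real ^ 'n ^ 'n::finite \<Rightarrow> 'n \<Rightarrow> 'n \<Rightarrow> nat \<Rightarrow> 'n \<Rightarrow> real" where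
  "passage_weight S i j 0 k = S $ k $ j"
| "passage_weight S i j (Suc n) k = (\<Sum>l\<in>-{i, j}. S $ k $ l * passage_weight S i j n l)"

lemma sum_passage_weight_Suc:
  "(\<Sum>n<Suc N. passage_weight S i j n k)
    = S $ k $ j + (\<Sum>l\<in>-{i, j}. S $ k $ l * (\<Sum>n<N. passage_weight S i j n l))"
  by (subst sum.lessThan_Suc_shift) (simp add: sum_distrib_left sum.swap[of _ "- {i, j}"])

text \<open>
  Divided by the commute time, the function \<open>U\<close> in the proof is the probability of reaching \<open>j\<close>
  before \<open>i\<close> under \<open>F\<close>: it is harmonic away from \<open>i\<close> and \<open>j\<close>, and its point source at \<open>i\<close> is
  \<open>1 / \<pi>\<^sub>i\<close>.  As \<open>F\<close> dominates \<open>S\<close>, the partial sums of passage weights of \<open>S\<close> stay below that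
  probability.  At the start \<open>i\<close> the full entry \<open>F\<^sub>i\<^sub>j\<close> is kept for the direct step, and only the
  longer passages are compared.
\<close>
lemma commute_time_passage_bound:
  assumes F: "stochastic F" "irreducible_mat F"
    and S: "substochastic S" "\<And>i j. S $ i $ j \<le> F $ i $ j" and ij: "i \<noteq> j"
  shows "invariant_distribution F $ i * mean_commute_time F i j
    * (F $ i $ j - S $ i $ j + (\<Sum>n<N. passage_weight S i j n i)) \<le> 1"
proof -
  let ?h = "\<lambda>k. mean_hitting_time F k" and ?c = "mean_commute_time F i j"
  have Snn: "0 \<le> S $ k $ l" for k l using S(1) by (simp add: substochastic_def)
  have Fnn: "0 \<le> F $ k $ l" for k l using F(1) by (simp add: stochastic_def)
  have hnn: "0 \<le> ?h k $ l" for k l by (rule mean_hitting_time_nonneg[OF F])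
  define U where "U = (\<chi> k. ?h j $ i - ?h j $ k + ?h i $ k)"
  have Ui: "U $ i = 0" and Uj: "U $ j = ?c"
    by (simp_all add: U_def mean_commute_time_def mean_hitting_time(1)[OF F])
  have U_nonneg: "0 \<le> U $ k" for k
    using mean_hitting_time_triangle[OF F, of j k i] by (simp add: U_def)
  have FU: "(F *v U) $ k = U $ k + (if k = i then mean_return_time F i else 0)
      - (if k = j then mean_return_time F j else 0)" for k
  proof -
    have "U = ?h j $ i *\<^sub>R 1 - ?h j + ?h i" by (simp add: U_def vec_eq_iff)
    moreover have "(F *v 1) $ k = 1"
      using F(1) by (simp add: matrix_vector_mult_def stochastic_def)
    ultimately show ?thesis
      using mean_hitting_time_Poisson[OF F, of i k] mean_hitting_time_Poisson[OF F, of j k]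
      by (simp add: matrix_vector_right_distrib matrix_vector_mult_diff_distrib
          matrix_vector_mult_scaleR)
  qed
  have split: "(F *v U) $ k = F $ k $ j * ?c + (\<Sum>l\<in>-{i, j}. F $ k $ l * U $ l)" for k
  proof -
    have "UNIV = insert i (insert j (-{i, j}))" by auto
    then have "(F *v U) $ k = (\<Sum>l\<in>insert i (insert j (-{i, j})). F $ k $ l * U $ l)"
      by (simp add: matrix_vector_mult_def)
    also have "\<dots> = F $ k $ j * ?c + (\<Sum>l\<in>-{i, j}. F $ k $ l * U $ l)"
      using ij by (simp add: Ui Uj)
    finally show ?thesis .
  qed
  have c_nonneg: "0 \<le> ?c" using U_nonneg[of j] Uj by simp
  let ?a = "\<lambda>N k. \<Sum>n<N. passage_weight S i j n k"
  have inner: "(\<Sum>l\<in>-{i, j}. S $ k $ l * ?a N l) * ?c \<le> (\<Sum>l\<in>-{i, j}. F $ k $ l * U $ l)"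
    if "\<And>l. l \<notin> {i, j} \<Longrightarrow> ?a N l * ?c \<le> U $ l" for N k
    unfolding sum_distrib_right
  proof (rule sum_mono)
    fix l assume "l \<in> - {i, j}"
    then have "?a N l * ?c \<le> U $ l" using that by blast
    then have "S $ k $ l * (?a N l * ?c) \<le> F $ k $ l * U $ l"
      by (rule order_trans[OF mult_left_mono[OF _ Snn] mult_right_mono[OF S(2) U_nonneg]])
    then show "S $ k $ l * ?a N l * ?c \<le> F $ k $ l * U $ l" by (simp add: mult.assoc)
  qed
  have a_le: "?a N k * ?c \<le> U $ k" if "k \<notin> {i, j}" for k N
    using that
  proof (induction N arbitrary: k)
    case 0
    then show ?case using U_nonneg by simp
  next
    case (Suc N)
    have "?a (Suc N) k * ?c \<le> F $ k $ j * ?c + (\<Sum>l\<in>-{i, j}. F $ k $ l * U $ l)"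
      unfolding sum_passage_weight_Suc distrib_right
      by (intro add_mono mult_right_mono S(2) c_nonneg inner Suc.IH)
    also have "\<dots> = U $ k" using Suc.prems FU[of k] split[of k] by simp
    finally show ?case .
  qed
  have "(F $ i $ j - S $ i $ j + ?a N i) * ?c \<le> mean_return_time F i"
  proof (cases N)
    case 0
    have "(F $ i $ j - S $ i $ j) * ?c \<le> F $ i $ j * ?c"
      by (intro mult_right_mono c_nonneg) (simp add: Snn)
    also have "\<dots> \<le> (F *v U) $ i"
      unfolding split by (simp add: sum_nonneg Fnn U_nonneg)
    finally show ?thesis using ij 0 by (simp add: FU Ui)
  next
    case (Suc M)
    have "(F $ i $ j - S $ i $ j + ?a N i) * ?c
        = F $ i $ j * ?c + (\<Sum>l\<in>-{i, j}. S $ i $ l * ?a M l) * ?c"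
      unfolding Suc sum_passage_weight_Suc by (simp add: algebra_simps)
    also have "\<dots> \<le> (F *v U) $ i"
      unfolding split by (intro add_left_mono inner a_le)
    finally show ?thesis using ij by (simp add: FU Ui)
  qed
  then show ?thesis
    using mean_return_time_ge_1[OF F, of i]
    by (simp add: invariant_distribution(3)[OF F] field_simps)
qed

section \<open>The passage probability as a sum over paths\<close>

lemma less_hitting_time_iff:
  "enat n < hitting_time k X \<longleftrightarrow> (\<forall>s. 0 < s \<and> s \<le> n \<longrightarrow> X s \<noteq> k)"
proof
  assume less: "enat n < hitting_time k X"
  show "\<forall>s. 0 < s \<and> s \<le> n \<longrightarrow> X s \<noteq> k"
  proof (intro allI impI notI)
    fix s assume "0 < s \<and> s \<le> n" "X s = k"
    then have "hitting_time k X \<le> enat s"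
      unfolding hitting_time_def by (intro Inf_lower) auto
    also have "\<dots> \<le> enat n" using \<open>0 < s \<and> s \<le> n\<close> by simp
    finally show False using less by simp
  qed
next
  assume avoid: "\<forall>s. 0 < s \<and> s \<le> n \<longrightarrow> X s \<noteq> k"
  have "enat (Suc n) \<le> hitting_time k X"
    unfolding hitting_time_def using avoid by (intro Inf_greatest) (auto simp: not_less_eq_eq)
  then show "enat n < hitting_time k X" by (simp add: Suc_ile_eq)
qed

lemma hitting_time_less_min_iff:
  assumes "j \<noteq> i" and "j \<noteq> w"
  shows "hitting_time j X < min (hitting_time i X) (hitting_time w X)
    \<longleftrightarrow> (\<exists>n. X (Suc n) = j \<and> (\<forall>t. 0 < t \<and> t \<le> n \<longrightarrow> X t \<notin> {j, i, w}))"
proof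
  assume less: "hitting_time j X < min (hitting_time i X) (hitting_time w X)"
  then obtain s where s: "hitting_time j X = enat s"
    by (metis enat_ord_simps(4) not_infinity_eq less_le_trans top_greatest top_enat_def)
  from s less have avoid: "X t \<noteq> i" "X t \<noteq> w" if "0 < t" "t \<le> s" for t
    using that less_hitting_time_iff[of s i X] less_hitting_time_iff[of s w X] by auto
  have "\<not> enat s < hitting_time j X" using s by simp
  then obtain s' where s': "0 < s'" "s' \<le> s" "X s' = j"
    by (auto simp: less_hitting_time_iff)
  have first: "X t \<noteq> j" if "0 < t" "t < s" for t
    using that less_hitting_time_iff[of t j X] s by auto
  with s' have "X s = j" by (cases "s' = s") auto
  moreover obtain n where n: "s = Suc n" using s' by (cases s) auto
  moreover have "X t \<notin> {j, i, w}" if "0 < t" "t \<le> n" for t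
    using first[of t] avoid[of t] that n by auto
  ultimately show "\<exists>n. X (Suc n) = j \<and> (\<forall>t. 0 < t \<and> t \<le> n \<longrightarrow> X t \<notin> {j, i, w})"
    by blast
next
  assume "\<exists>n. X (Suc n) = j \<and> (\<forall>t. 0 < t \<and> t \<le> n \<longrightarrow> X t \<notin> {j, i, w})"
  then obtain n where n: "X (Suc n) = j" "\<And>t. 0 < t \<Longrightarrow> t \<le> n \<Longrightarrow> X t \<notin> {j, i, w}" by auto
  have "\<not> enat (Suc n) < hitting_time j X"
    using n(1) by (auto simp: less_hitting_time_iff)
  moreover have "enat (Suc n) < hitting_time i X" "enat (Suc n) < hitting_time w X"
    using n assms by (auto simp: less_hitting_time_iff le_Suc_eq)
  ultimately show "hitting_time j X < min (hitting_time i X) (hitting_time w X)"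
    by (auto simp: min_def)
qed

text \<open>
  The product form of a path's weight is the one in which the law of the chain gives the
  probability of a cylinder set.
\<close>
lemma passage_weight_eq_sum_paths:
  "passage_weight S i j n k = (\<Sum>xs | set xs \<subseteq> -{i, j} \<and> length xs = n.
    \<Prod>t<Suc n. S $ ((k # xs @ [j]) ! t) $ ((k # xs @ [j]) ! Suc t))"
proof (induction n arbitrary: k)
  case 0
  have "{xs. set xs \<subseteq> -{i, j} \<and> length xs = 0} = {[]}" by auto
  then show ?case by simp
next
  case (Suc n)
  let ?L = "{xs. set xs \<subseteq> -{i, j} \<and> length xs = n}"
  let ?w = "\<lambda>k xs m. \<Prod>t<m. S $ ((k # xs @ [j]) ! t) $ ((k # xs @ [j]) ! Suc t)"
  have inj: "inj_on (\<lambda>(xs, l). l # xs) (?L \<times> -{i, j})" by (auto simp: inj_on_def)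
  have w: "?w k (l # xs) (Suc (Suc m)) = S $ k $ l * ?w l xs (Suc m)" for l xs m
    by (subst prod.lessThan_Suc_shift) simp
  have "(\<Sum>xs | set xs \<subseteq> -{i, j} \<and> length xs = Suc n. ?w k xs (Suc (Suc n)))
      = (\<Sum>(xs, l)\<in>?L \<times> -{i, j}. S $ k $ l * ?w l xs (Suc n))"
    unfolding lists_length_Suc_eq sum.reindex[OF inj]
    by (intro sum.cong refl) (clarify, simp only: o_def prod.case w)
  also have "\<dots> = (\<Sum>xs\<in>?L. \<Sum>l\<in>-{i, j}. S $ k $ l * ?w l xs (Suc n))"
    by (simp add: sum.cartesian_product del: prod.lessThan_Suc)
  also have "\<dots> = (\<Sum>l\<in>-{i, j}. S $ k $ l * (\<Sum>xs\<in>?L. ?w l xs (Suc n)))"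
    unfolding sum_distrib_left by (rule sum.swap)
  also have "\<dots> = passage_weight S i j (Suc n) k"
    by (simp add: Suc.IH del: prod.lessThan_Suc)
  finally show ?case by simp
qed

text \<open>
  Up to the null event that the chain does not start at \<open>i\<close>, the event defining \<open>Q\<^sub>i\<^sub>j(S)\<close> is the
  disjoint union over \<open>n\<close> of the events that \<open>j\<close> is first visited at time \<open>n + 1\<close> without an
  intermediate visit to \<open>i\<close> or to the absorbing state.  Each of these is a finite disjoint union of
  cylinder sets, one for every list of intermediate states.
\<close>
lemma Q_passage_sums:
  fixes S :: "real ^ 'n ^ 'n::finite"
  assumes S: "substochastic S" and ij: "i \<noteq> j"
  shows "(\<lambda>n. passage_weight S i j n i) sums Q_passage S i j"
proof -
  define M where "M = markov_chain (absorbing_extension S) (Some i)"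
  note stoch = stochastic_absorbing_extension[OF S]
  interpret prob_space M unfolding M_def by (rule prob_space_markov_chain[OF stoch])
  have sets_M: "sets M = sets (Pi\<^sub>M UNIV (\<lambda>_. count_space UNIV))"
    unfolding M_def by (rule sets_markov_chain[OF stoch])
  have space_M: "space M = UNIV"
    using sets_eq_imp_space_eq[OF sets_M] by (simp add: space_PiM)
  have coord [measurable]: "(\<lambda>X. X t) \<in> M \<rightarrow>\<^sub>M count_space UNIV" for t
    unfolding measurable_cong_sets[OF sets_M refl] by (rule measurable_component_singleton) simp
  have cyl: "measure M {X \<in> space M. \<forall>t\<le>n. X t = y t} =
      (if y 0 = Some i then \<Prod>t<n. absorbing_extension S $ y t $ y (Suc t) else 0)" for n y
    unfolding M_def by (rule measure_markov_chain_cylinder[OF stoch])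
  define path where "path xs = (\<lambda>t. Some ((i # xs @ [j]) ! t))" for xs
  define C where "C n xs = {X \<in> space M. \<forall>t\<le>Suc n. X t = path xs t}" for n xs
  define L where "L n = {xs. set xs \<subseteq> -{i, j} \<and> length xs = n}" for n
  define E where "E n = {X \<in> space M. X 0 = Some i \<and> X (Suc n) = Some j
    \<and> (\<forall>t. 0 < t \<and> t \<le> n \<longrightarrow> X t \<notin> {Some j, Some i, None})}" for n
  have C_sets [measurable]: "C n xs \<in> sets M" for n xs unfolding C_def by measurable
  have E_sets [measurable]: "E n \<in> sets M" for n unfolding E_def by measurable
  have E_eq: "E n = (\<Union>xs\<in>L n. C n xs)" for n
  proof (intro equalityI subsetI)
    fix X assume X: "X \<in> E n"
    have ex: "\<exists>l. X t = Some l \<and> l \<noteq> i \<and> l \<noteq> j" if "0 < t" "t \<le> n" for t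
      using X that by (cases "X t") (auto simp: E_def)
    define xs where "xs = map (\<lambda>t. the (X (Suc t))) [0..<n]"
    have "the (X (Suc t)) \<notin> {i, j}" if "t < n" for t
      using ex[of "Suc t"] that by auto
    then have xs: "xs \<in> L n" by (simp add: L_def xs_def image_subset_iff)
    have "X t = path xs t" if "t \<le> Suc n" for t
    proof (cases t)
      case 0
      then show ?thesis using X by (simp add: E_def path_def)
    next
      case (Suc u)
      show ?thesis
      proof (cases "u = n")
        case True
        then show ?thesis using X Suc by (simp add: E_def path_def xs_def nth_append)
      next
        case False
        then have "u < n" using Suc that by simp
        then show ?thesis using ex[of "Suc u"] Suc by (auto simp: path_def xs_def nth_append)
      qed
    qed
    then show "X \<in> (\<Union>xs\<in>L n. C n xs)" using xs by (auto simp: C_def space_M)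
  next
    fix X assume "X \<in> (\<Union>xs\<in>L n. C n xs)"
    then obtain xs where xs: "xs \<in> L n" and X: "\<And>t. t \<le> Suc n \<Longrightarrow> X t = path xs t"
      by (auto simp: C_def)
    have "X t \<notin> {Some j, Some i, None}" if t: "0 < t" "t \<le> n" for t
    proof -
      obtain u where u: "t = Suc u" "u < n" using t by (cases t) auto
      then have "xs ! u \<in> set xs" using xs by (simp add: L_def)
      moreover have "X t = Some (xs ! u)"
        using X[of t] u xs by (simp add: path_def L_def nth_append)
      ultimately show ?thesis using xs by (auto simp: L_def)
    qed
    then show "X \<in> E n"
      using X[of 0] X[of "Suc n"] xs by (auto simp: E_def space_M path_def L_def nth_append)
  qed
  have "C n xs \<inter> C n ys = {}" if *: "xs \<in> L n" "ys \<in> L n" "xs \<noteq> ys" for n xs ys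
  proof -
    from * obtain u where u: "u < n" "xs ! u \<noteq> ys ! u"
      using nth_equalityI[of xs ys] by (auto simp: L_def)
    then have "path xs (Suc u) \<noteq> path ys (Suc u)"
      using * by (simp add: path_def L_def nth_append)
    then show ?thesis using u by (auto simp: C_def dest!: spec[where x = "Suc u"])
  qed
  then have "disjoint_family_on (C n) (L n)" for n by (simp add: disjoint_family_on_def)
  then have "measure M (E n) = (\<Sum>xs\<in>L n. measure M (C n xs))" for n
    unfolding E_eq by (intro finite_measure_finite_Union) (auto simp: L_def finite_lists_length_eq)
  then have E_measure: "measure M (E n) = passage_weight S i j n i" for n
    unfolding passage_weight_eq_sum_paths L_def C_def cyl
    by (simp add: path_def absorbing_extension_def del: prod.lessThan_Suc)
  have "disjoint_family E"
  proof -
    have "E m \<inter> E n = {}" if "m < n" for m n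
      using that by (auto simp: E_def dest!: spec[where x = "Suc m"])
    then show ?thesis
      unfolding disjoint_family_on_def by (metis Int_commute nat_neq_iff)
  qed
  then have "(\<lambda>n. measure M (E n)) sums measure M (\<Union>n. E n)"
    by (intro finite_measure_UNION) auto
  also have "measure M (\<Union>n. E n) = Q_passage S i j"
  proof -
    let ?H = "{X \<in> space M. hitting_time (Some j) X
      < min (hitting_time (Some i) X) (hitting_time None X)}"
    have H: "?H = {X \<in> space M. \<exists>n. X (Suc n) = Some j
        \<and> (\<forall>t. 0 < t \<and> t \<le> n \<longrightarrow> X t \<notin> {Some j, Some i, None})}"
      using ij by (subst hitting_time_less_min_iff) auto
    have H_sets: "?H \<in> sets M" unfolding H by measurable
    have "\<P>(X in M. X 0 = Some i) = 1"
      using cyl[of 0 "\<lambda>_. Some i"] by simp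
    then have "AE X in M. X 0 = Some i"
      by (subst (asm) prob_Collect_eq_1) auto
    then have "AE X in M. X \<in> (\<Union>n. E n) \<longleftrightarrow> X \<in> ?H"
      unfolding H by eventually_elim (auto simp: E_def)
    then have "measure M (\<Union>n. E n) = measure M ?H"
      by (rule finite_measure_eq_AE) (use H_sets in auto)
    then show ?thesis by (simp add: Q_passage_def M_def)
  qed
  finally show ?thesis unfolding E_measure .
qed

lemma passage_weight_nonneg:
  assumes "substochastic S"
  shows "0 \<le> passage_weight S i j n k"
  using assms by (induction n arbitrary: k) (auto simp: substochastic_def intro!: sum_nonneg)

text \<open>
  Irreducibility yields a path from \<open>i\<close> to \<open>j\<close>; the part of it after the last visit to \<open>i\<close>
  contains a passage of positive weight.
\<close>
lemma Q_passage_pos: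
  assumes S: "substochastic S" "irreducible_mat S" and ij: "i \<noteq> j"
  shows "0 < Q_passage S i j"
proof -
  have nonneg: "0 \<le> S $ k $ l" for k l using S(1) by (simp add: substochastic_def)
  have w_nonneg: "0 \<le> passage_weight S i j n k" for n k
    by (rule passage_weight_nonneg[OF S(1)])
  have "(i, j) \<in> {(k, l). S $ k $ l \<noteq> 0}\<^sup>*"
    using S(2) by (simp add: irreducible_mat_def)
  \<comment> \<open>Going backwards along the path, the last disjunct records that a visit to \<open>i\<close> has been found,
    from which the passage weight cannot be continued.\<close>
  then have "i = j \<or> (\<exists>n. 0 < passage_weight S i j n i) \<or> (\<exists>n. 0 < passage_weight S i j n i)"
  proof (induction rule: converse_rtrancl_induct[where P = "\<lambda>k. k = j
      \<or> (\<exists>n. 0 < passage_weight S i j n k) \<or> (\<exists>n. 0 < passage_weight S i j n i)"])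
    case base
    then show ?case by simp
  next
    case (step k l)
    then have pos: "0 < S $ k $ l" using nonneg[of k l] by simp
    from step.IH consider "l = j" | "\<exists>n. 0 < passage_weight S i j n i"
      | n where "l \<notin> {i, j}" "0 < passage_weight S i j n l" by auto
    then show ?case
    proof cases
      case 1
      then have "0 < passage_weight S i j 0 k" using pos by simp
      then show ?thesis by blast
    next
      case 2
      then show ?thesis by blast
    next
      case (3 n)
      have "0 < S $ k $ l * passage_weight S i j n l" using pos 3 by simp
      also have "\<dots> \<le> passage_weight S i j (Suc n) k"
        unfolding passage_weight.simps using 3
        by (intro member_le_sum) (auto simp: nonneg w_nonneg)
      finally show ?thesis by blast
    qed
  qed
  then obtain n where n: "0 < passage_weight S i j n i" using ij by auto
  have sums: "(\<lambda>n. passage_weight S i j n i) sums Q_passage S i j"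
    by (rule Q_passage_sums[OF S(1) ij])
  then have "0 < (\<Sum>n. passage_weight S i j n i)"
    by (intro suminf_pos2[of _ n] w_nonneg n sums_summable)
  then show ?thesis using sums_unique[OF sums] by simp
qed

lemma commute_time_Q_passage_bound:
  assumes F: "stochastic F" "irreducible_mat F"
    and S: "substochastic S" "\<And>i j. S $ i $ j \<le> F $ i $ j" and ij: "i \<noteq> j"
  shows "invariant_distribution F $ i * mean_commute_time F i j
    * (F $ i $ j - S $ i $ j + Q_passage S i j) \<le> 1"
proof (rule LIMSEQ_le_const2)
  show "(\<lambda>N. invariant_distribution F $ i * mean_commute_time F i j
      * (F $ i $ j - S $ i $ j + (\<Sum>n<N. passage_weight S i j n i)))
    \<longlonglongrightarrow> invariant_distribution F $ i * mean_commute_time F i j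
      * (F $ i $ j - S $ i $ j + Q_passage S i j)"
    using Q_passage_sums[OF S(1) ij] by (intro tendsto_intros) (simp add: sums_def)
qed (use commute_time_passage_bound[OF F S ij] in blast)

section \<open>Perturbation of the invariant distribution\<close>

text \<open>
  Pair the Poisson equation for the hitting times of \<open>m\<close> under \<open>F\<close> with the invariant
  distribution of \<open>G\<close>; since \<open>G - F\<close> has zero row sums, only the differences \<open>h\<^sub>i - h\<^sub>j\<close> matter.
  The identity is exact, with \<open>\<pi>(G)\<close> on the right-hand side, so it gives both continuity and the
  derivative of \<open>\<pi>\<close>.
\<close>
lemma invariant_distribution_perturbation:
  assumes F: "stochastic F" "irreducible_mat F" and G: "stochastic G" "irreducible_mat G"
  shows "invariant_distribution G $ m - invariant_distribution F $ m
    = invariant_distribution F $ m * (\<Sum>(i, j)\<in>{(i, j). i \<noteq> j}. invariant_distribution G $ i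
        * (G $ i $ j - F $ i $ j) * (mean_hitting_time F m $ i - mean_hitting_time F m $ j))"
proof -
  let ?h = "mean_hitting_time F m" and ?p = "invariant_distribution G"
  let ?r = "mean_return_time F m"
  have row: "(\<Sum>j\<in>UNIV. G $ i $ j - F $ i $ j) = 0" for i
    using F(1) G(1) by (simp add: stochastic_def sum_subtractf)
  have "(\<Sum>(i, j)\<in>{(i, j). i \<noteq> j}. ?p $ i * (G $ i $ j - F $ i $ j) * (?h $ i - ?h $ j))
    = (\<Sum>(i, j)\<in>UNIV. ?p $ i * (G $ i $ j - F $ i $ j) * (?h $ i - ?h $ j))"
    by (rule sum.mono_neutral_left) auto
  also have "\<dots> = (\<Sum>i\<in>UNIV. \<Sum>j\<in>UNIV. ?p $ i * (G $ i $ j - F $ i $ j) * (?h $ i - ?h $ j))"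
    by (simp add: sum.cartesian_product)
  also have "\<dots> = (\<Sum>i\<in>UNIV. ?p $ i * ?h $ i * (\<Sum>j\<in>UNIV. G $ i $ j - F $ i $ j)
      - ?p $ i * ((G *v ?h) $ i - (F *v ?h) $ i))"
    by (intro sum.cong refl)
      (simp add: sum_distrib_left matrix_vector_mult_def algebra_simps flip: sum_subtractf)
  also have "\<dots> = ?p \<bullet> (F *v ?h) - ?p \<bullet> (G *v ?h)"
    by (simp add: row inner_vec_def algebra_simps flip: sum_subtractf)
  also have "?p \<bullet> (G *v ?h) = ?p \<bullet> ?h"
    using dot_lmul_matrix[of ?p G ?h] invariant_distribution(1)[OF G] by simp
  also have "?p \<bullet> (F *v ?h) - ?p \<bullet> ?h
      = (\<Sum>k\<in>UNIV. ?p $ k * - (?h $ k - (F *v ?h) $ k))"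
    by (simp add: inner_vec_def algebra_simps flip: sum_subtractf)
  also have "\<dots> = ?p $ m * ?r - (\<Sum>k\<in>UNIV. ?p $ k)"
    by (simp add: mean_hitting_time_Poisson[OF F] right_diff_distrib sum_subtractf if_distrib[of "(*) _"] cong: if_cong)
  also have "\<dots> = ?p $ m * ?r - 1" using invariant_distribution(2)[OF G] by simp
  finally show ?thesis
    using mean_return_time_ge_1[OF F, of m]
    by (simp add: invariant_distribution(3)[OF F] field_simps)
qed

text \<open>
  The perturbation formula turns the difference quotient at \<open>s\<close> into a sum in which only \<open>\<pi>(G(t))\<close>
  depends on \<open>t\<close>.  This factor is bounded by \<open>1\<close>, so the same formula shows that it is continuous.
\<close>
lemma log_invariant_distribution_has_derivative:
  fixes F F' :: "real ^ 'n ^ 'n::finite"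
  defines "G \<equiv> \<lambda>s. F + s *\<^sub>R (F' - F)"
  assumes G: "\<And>s. s \<in> {0..1} \<Longrightarrow> stochastic (G s)" "\<And>s. s \<in> {0..1} \<Longrightarrow> irreducible_mat (G s)"
    and s: "s \<in> {0..1}"
  shows "((\<lambda>s. ln (invariant_distribution (G s) $ m)) has_real_derivative
    (\<Sum>(i, j)\<in>{(i, j). i \<noteq> j}. invariant_distribution (G s) $ i * (F' $ i $ j - F $ i $ j)
      * (mean_hitting_time (G s) m $ i - mean_hitting_time (G s) m $ j))) (at s within {0..1})"
proof -
  let ?p = "\<lambda>t m. invariant_distribution (G t) $ m" and ?h = "mean_hitting_time (G s)"
  let ?sum = "\<lambda>t m. \<Sum>(i, j)\<in>{(i, j). i \<noteq> j}. ?p t i * (F' $ i $ j - F $ i $ j)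
      * (?h m $ i - ?h m $ j)"
  have pos: "0 < ?p t m" if "t \<in> {0..1}" for t m
    using invariant_distribution_pos[OF G[OF that]] .
  have le1: "?p t m \<le> 1" if "t \<in> {0..1}" for t m
    using mean_return_time_ge_1[OF G[OF that], of m]
    by (simp add: invariant_distribution(3)[OF G[OF that]])
  have diff: "?p t m - ?p s m = (t - s) * (?p s m * ?sum t m)" if "t \<in> {0..1}" for t m
  proof -
    have "G t $ i $ j - G s $ i $ j = (t - s) * (F' $ i $ j - F $ i $ j)" for i j
      by (simp add: G_def algebra_simps)
    then show ?thesis
      unfolding invariant_distribution_perturbation[OF G[OF s] G[OF that]]
      by (simp only: sum_distrib_left case_prod_unfold mult_ac)
  qed
  have lim: "((\<lambda>t. ?p t m) \<longlongrightarrow> ?p s m) (at s within {0..1})" for m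
  proof -
    define B where "B = ?p s m * (\<Sum>(i, j)\<in>{(i, j). i \<noteq> j}. \<bar>(F' $ i $ j - F $ i $ j)
      * (?h m $ i - ?h m $ j)\<bar>)"
    have "norm (?p t m - ?p s m) \<le> \<bar>t - s\<bar> * B" if "t \<in> {0..1}" for t
    proof -
      have "\<bar>?sum t m\<bar> \<le> (\<Sum>(i, j)\<in>{(i, j). i \<noteq> j}. \<bar>(F' $ i $ j - F $ i $ j)
          * (?h m $ i - ?h m $ j)\<bar>)"
      proof (rule order_trans[OF sum_abs], rule sum_mono, clarify)
        fix i j
        have "\<bar>?p t i\<bar> * \<bar>(F' $ i $ j - F $ i $ j) * (?h m $ i - ?h m $ j)\<bar>
            \<le> 1 * \<bar>(F' $ i $ j - F $ i $ j) * (?h m $ i - ?h m $ j)\<bar>"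
          using le1[OF that, of i] pos[OF that, of i] by (intro mult_right_mono) auto
        then show "\<bar>?p t i * (F' $ i $ j - F $ i $ j) * (?h m $ i - ?h m $ j)\<bar>
            \<le> \<bar>(F' $ i $ j - F $ i $ j) * (?h m $ i - ?h m $ j)\<bar>"
          by (simp add: abs_mult mult.assoc)
      qed
      then have "?p s m * \<bar>?sum t m\<bar> \<le> B"
        unfolding B_def using pos[OF s, of m] by (intro mult_left_mono) simp_all
      then have "\<bar>t - s\<bar> * (?p s m * \<bar>?sum t m\<bar>) \<le> \<bar>t - s\<bar> * B"
        by (rule mult_left_mono) simp
      then show ?thesis
        unfolding diff[OF that] real_norm_def abs_mult abs_of_pos[OF pos[OF s]] .
    qed
    then have "\<forall>\<^sub>F t in at s within {0..1}. norm (?p t m - ?p s m) \<le> \<bar>t - s\<bar> * B"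
      unfolding eventually_at_filter by (intro always_eventually) blast
    moreover have "((\<lambda>t. \<bar>t - s\<bar> * B) \<longlongrightarrow> \<bar>s - s\<bar> * B) (at s within {0..1})"
      by (intro tendsto_intros)
    then have "((\<lambda>t. \<bar>t - s\<bar> * B) \<longlongrightarrow> 0) (at s within {0..1})"
      by (simp only: diff_self abs_zero mult_zero_left)
    ultimately have "((\<lambda>t. ?p t m - ?p s m) \<longlongrightarrow> 0) (at s within {0..1})"
      by (rule Lim_null_comparison)
    then show ?thesis by (rule LIM_zero_cancel)
  qed
  have "((\<lambda>t. ?p s m * ?sum t m) \<longlongrightarrow> ?p s m * ?sum s m) (at s within {0..1})"
    unfolding case_prod_unfold by (intro tendsto_intros lim)
  moreover have "\<forall>\<^sub>F t in at s within {0..1}. ?p s m * ?sum t m = (?p t m - ?p s m) / (t - s)"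
    unfolding eventually_at_filter
    by (intro always_eventually allI impI) (simp only: diff, simp)
  ultimately have "((\<lambda>t. (?p t m - ?p s m) / (t - s)) \<longlongrightarrow> ?p s m * ?sum s m) (at s within {0..1})"
    by (rule Lim_transform_eventually)
  then have deriv: "((\<lambda>t. ?p t m) has_real_derivative ?p s m * ?sum s m) (at s within {0..1})"
    unfolding has_field_derivative_iff .
  have "1 / ?p s m * (?p s m * ?sum s m) = ?sum s m"
    using pos[OF s, of m] by simp
  with DERIV_chain2[OF DERIV_ln_divide[OF pos[OF s, of m]] deriv] show ?thesis
    by (rule back_subst)
qed

theorem theorem3:
  fixes F F' S :: "real ^ 'n ^ 'n::finite"
  assumes "stochastic F" and "stochastic F'"
    and "substochastic S" and "irreducible_mat S"
    and "\<And>i j. S $ i $ j \<le> F $ i $ j" and "\<And>i j. S $ i $ j \<le> F' $ i $ j"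
  shows "\<bar>ln (invariant_distribution F' $ m) - ln (invariant_distribution F $ m)\<bar>
    \<le> (\<Sum>(i, j)\<in>{(i, j). i \<noteq> j}.
          \<bar>ln (F' $ i $ j - S $ i $ j + Q_passage S i j)
            - ln (F $ i $ j - S $ i $ j + Q_passage S i j)\<bar>)"
proof -
  define G where "G s = F + s *\<^sub>R (F' - F)" for s
  have G_nth: "G s $ i $ j = (1 - s) * F $ i $ j + s * F' $ i $ j" for s i j
    by (simp add: G_def algebra_simps)
  have G_ge: "S $ i $ j \<le> G s $ i $ j" if "s \<in> {0..1}" for s i j
    using convex_bound_le[of "- F $ i $ j" "- S $ i $ j" "- F' $ i $ j" "1 - s" s]
      assms(5,6)[of i j] that by (simp add: G_nth)
  have G_stoch: "stochastic (G s)" if "s \<in> {0..1}" for s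
    using assms(1,2) that
    by (auto simp: stochastic_def G_nth sum.distrib simp flip: sum_distrib_left)
  have G_irr: "irreducible_mat (G s)" if "s \<in> {0..1}" for s
    by (rule irreducible_mat_mono[OF assms(4,3) G_ge[OF that]])
  define x where "x i j s = G s $ i $ j - S $ i $ j + Q_passage S i j" for i j s
  have x_pos: "0 < x i j s" if "s \<in> {0..1}" "i \<noteq> j" for i j s
    using G_ge[OF that(1), of i j] Q_passage_pos[OF assms(3,4) that(2)] by (simp add: x_def)
  let ?I = "{(i, j). i \<noteq> j} :: ('n \<times> 'n) set"
  define g where "g s = ln (invariant_distribution (G s) $ m)" for s
  define g' where "g' s = (\<Sum>(i, j)\<in>?I. invariant_distribution (G s) $ i * (F' $ i $ j - F $ i $ j)
      * (mean_hitting_time (G s) m $ i - mean_hitting_time (G s) m $ j))" for s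
  \<comment> \<open>The signs make every summand nondecreasing along the segment, so that \<open>\<phi>\<close> grows at the total
    speed of all the logarithms.\<close>
  define \<phi> where "\<phi> s = (\<Sum>(i, j)\<in>?I. sgn (F' $ i $ j - F $ i $ j) * ln (x i j s))" for s
  define \<phi>' where "\<phi>' s = (\<Sum>(i, j)\<in>?I. \<bar>F' $ i $ j - F $ i $ j\<bar> / x i j s)" for s
  have g_deriv: "(g has_real_derivative g' s) (at s within {0..1})" if "s \<in> {0..1}" for s
    unfolding g_def g'_def G_def
    by (rule log_invariant_distribution_has_derivative)
      (use that G_stoch G_irr in \<open>auto simp: G_def\<close>)
  have x_deriv: "(x i j has_real_derivative F' $ i $ j - F $ i $ j) (at s within {0..1})" for i j s
    unfolding x_def G_nth by (auto intro!: derivative_eq_intros)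
  have \<phi>_deriv: "(\<phi> has_real_derivative \<phi>' s) (at s within {0..1})" if "s \<in> {0..1}" for s
  proof -
    have "((\<lambda>s. sgn (F' $ i $ j - F $ i $ j) * ln (x i j s)) has_real_derivative
        \<bar>F' $ i $ j - F $ i $ j\<bar> / x i j s) (at s within {0..1})" if "i \<noteq> j" for i j
      using x_pos[OF \<open>s \<in> {0..1}\<close> that]
      by (auto intro!: derivative_eq_intros x_deriv simp: abs_sgn)
    then show ?thesis
      unfolding \<phi>_def[abs_def] \<phi>'_def case_prod_unfold by (intro DERIV_sum) auto
  qed
  have bound: "\<bar>g' s\<bar> \<le> \<phi>' s" if s: "s \<in> {0..1}" for s
    unfolding g'_def \<phi>'_def
  proof (rule order_trans[OF sum_abs], rule sum_mono, clarify)
    fix i j :: 'n assume ij: "i \<noteq> j"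
    note Gs = G_stoch[OF s] G_irr[OF s]
    let ?p = "invariant_distribution (G s) $ i" and ?c = "mean_commute_time (G s) i j"
    let ?D = "F' $ i $ j - F $ i $ j"
    let ?d = "mean_hitting_time (G s) m $ i - mean_hitting_time (G s) m $ j"
    have "?p * ?c * x i j s \<le> 1"
      unfolding x_def by (rule commute_time_Q_passage_bound[OF Gs assms(3) G_ge[OF s] ij])
    then have "?p * ?c \<le> 1 / x i j s"
      using x_pos[OF s ij] by (simp add: field_simps)
    moreover have "?p * \<bar>?d\<bar> \<le> ?p * ?c"
      using invariant_distribution_pos[OF Gs, of i]
      by (intro mult_left_mono mean_hitting_time_diff_le_commute[OF Gs]) simp
    ultimately have "\<bar>?D\<bar> * (?p * \<bar>?d\<bar>) \<le> \<bar>?D\<bar> * (1 / x i j s)"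
      by (intro mult_left_mono) auto
    then show "\<bar>?p * ?D * ?d\<bar> \<le> \<bar>?D\<bar> / x i j s"
      using invariant_distribution_pos[OF Gs, of i] by (simp add: abs_mult mult_ac)
  qed
  \<comment> \<open>With \<open>e\<close> a sign, \<open>\<phi> - e g\<close> is nondecreasing; the two signs bound \<open>g\<close> from both sides.\<close>
  have "e * (g 1 - g 0) \<le> \<phi> 1 - \<phi> 0" if e: "\<bar>e\<bar> = 1" for e
  proof -
    have "((\<lambda>s. \<phi> s - e * g s) has_derivative (*) (\<phi>' s - e * g' s)) (at s within {0..1})"
      if "0 \<le> s" "s \<le> 1" for s
      unfolding has_field_derivative_def[symmetric]
      by (intro DERIV_diff DERIV_cmult \<phi>_deriv g_deriv) (use that in auto)
    from mvt_simple[OF zero_less_one this] obtain s where "s \<in> {0<..<1}"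
      and eq: "\<phi> 1 - e * g 1 - (\<phi> 0 - e * g 0) = (\<phi>' s - e * g' s) * (1 - 0)" by blast
    then have s: "s \<in> {0..1}" by simp
    have "e * g' s \<le> \<bar>e * g' s\<bar>" by simp
    also have "\<dots> \<le> \<phi>' s" using bound[OF s] e by (simp add: abs_mult)
    finally show ?thesis using eq by (simp add: algebra_simps)
  qed
  from this[of 1] this[of "-1"] have "\<bar>g 1 - g 0\<bar> \<le> \<phi> 1 - \<phi> 0" by (simp add: abs_le_iff)
  also have "\<dots> = (\<Sum>(i, j)\<in>?I. sgn (F' $ i $ j - F $ i $ j) * (ln (x i j 1) - ln (x i j 0)))"
    by (simp add: \<phi>_def case_prod_unfold right_diff_distrib sum_subtractf)
  also have "\<dots> \<le> (\<Sum>(i, j)\<in>?I. \<bar>ln (x i j 1) - ln (x i j 0)\<bar>)"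
    by (rule sum_mono) (auto simp: sgn_if)
  finally show ?thesis by (simp add: g_def x_def G_nth G_def)
qed

end
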